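(* Let $f:[0,\infty)\to\mathbb{R}$ be a function that is differentiable on $(0,\infty)$, let $0<u<v$, and suppose $f'\in L[u,v]$. Let $q>1$ and let $p$ satisfy $1/p+1/q=1$. If $|f'|^q$ is $s$-convex (in the second sense) on $[u,v]$ for some fixed $s\in(0,1]$, then for each $x\in[u,v]$, $$\left|\frac{(v-x)(vf(v)-uf(x))+(x-u)(vf(x)-uf(u))}{(v-u)^2}-\frac{1}{v-u}\int_u^v f(\mu)\,d\mu\right|$$ $$\le \frac{(v-x)^2}{(v-u)^2}L_p(u,v)\left(\frac{|f'(x)|^q+|f'(v)|^q}{s+1}\right)^{1/q}+\frac{(x-u)^2}{(v-u)^2}L_p(u,v)\left(\frac{|f'(x)|^q+|f'(u)|^q}{s+1}\right)^{1/q}.$$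
   Context: $L[u,v]$ denotes the space of Lebesgue integrable functions on $[u,v]$. For $s\in(0,1]$, a nonnegative function $g$ on an interval $[u,v]$ is $s$-convex (in the second sense) on $[u,v]$ if $g(ty+(1-t)z)\le t^s g(y)+(1-t)^s g(z)$ for all $y,z\in[u,v]$ and $t\in[0,1]$. The generalized logarithmic mean is $L_p(u,v)=\left(\frac{v^{p+1}-u^{p+1}}{(p+1)(v-u)}\right)^{1/p}$ for $u\neq v$, $u,v>0$, $p\in\mathbb{R}\setminus\{-1,0\}$. *)

theory Defs
  imports "HOL-Analysis.Analysis"
begin

text \<open>
  \<open>s\<close>-convexity in the second sense, intended for \<open>s\<close> with \<open>0 < s \<le> 1\<close> and \<open>I\<close> an interval.
  Nonnegativity of \<open>g\<close> on \<open>I\<close> is part of the notion. Note that \<open>0 powr s = 0\<close>, which agrees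
  with \<open>0\<^sup>s\<close> for \<open>s > 0\<close>, so the cases \<open>t = 0\<close> and \<open>t = 1\<close> have their usual meaning.
\<close>

definition s_convex_on :: "real \<Rightarrow> real set \<Rightarrow> (real \<Rightarrow> real) \<Rightarrow> bool" where
  "s_convex_on s I g \<longleftrightarrow>
     (\<forall>x\<in>I. 0 \<le> g x) \<and>
     (\<forall>y\<in>I. \<forall>z\<in>I. \<forall>t\<in>{0..1}.
        g (t * y + (1 - t) * z) \<le> t powr s * g y + (1 - t) powr s * g z)"

text \<open>Meaningful for \<open>u, v > 0\<close> with \<open>u \<noteq> v\<close> and \<open>p\<close> different from \<open>-1\<close> and \<open>0\<close>.\<close>

definition gen_log_mean :: "real \<Rightarrow> real \<Rightarrow> real \<Rightarrow> real" where
  "gen_log_mean p u v =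
     ((v powr (p + 1) - u powr (p + 1)) / ((p + 1) * (v - u))) powr (1 / p)"

end

theory Submission imports Defs begin

text \<open>
  The quantity under the absolute value on the left is, up to the factor \<open>(v - u)\<^sup>2\<close>, a combination
  of two weighted integrals of \<open>f'\<close>, one over \<open>[u, x]\<close> and one over \<open>[x, v]\<close>. On a subinterval \<open>[a, b]\<close> let
  \<open>W\<close> be the affine function that runs from \<open>W a = u\<close> to \<open>W b = v\<close>. Integration by parts gives
  \<open>\<integral>\<^sub>a\<^sup>b W f' = v f(b) - u f(a) - (v - u)/(b - a) \<integral>\<^sub>a\<^sup>b f\<close>, and multiplying this by \<open>b - a\<close> for the two
  subintervals and adding produces \<open>(v - u)\<^sup>2\<close> times that quantity.

  Each weighted integral is estimated by Hoelder's inequality. The integral of \<open>W\<^sup>p\<close> is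
  \<open>(b - a) L\<^sub>p(u, v)\<^sup>p\<close>, because the affine change of variable to \<open>w = W y\<close> turns it into an
  integral of \<open>w\<^sup>p\<close> over \<open>[u, v]\<close>. On \<open>[a, b]\<close> the \<open>s\<close>-convexity bounds
  \<open>\<bar>f'\<bar>\<^sup>q\<close> by \<open>\<theta>\<^sup>s \<bar>f'(b)\<bar>\<^sup>q + (1 - \<theta>)\<^sup>s \<bar>f'(a)\<bar>\<^sup>q\<close>, where \<open>\<theta>\<close> is the affine coordinate that runs
  from 0 to 1; both \<open>\<theta>\<^sup>s\<close> and \<open>(1 - \<theta>)\<^sup>s\<close> have integral \<open>(b - a)/(s + 1)\<close>.

  The three power integrals are instances of \<open>has_integral_affine_powr\<close>. Hoelder's inequality enters
  in the form \<open>Hoelder_with_majorants\<close>, stated for the Henstock-Kurzweil integral of the product: that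
  is the integral which the fundamental theorem of calculus provides for \<open>W f'\<close>, and the powers of the
  two factors only have to be dominated by the integrable functions above.
\<close>

text \<open>
  The two majorants are compared with the product through Young's inequality, pointwise. To divide by
  the two norms, they must be positive; hence both integrals are first enlarged by some \<open>\<epsilon> > 0\<close>, which
  is then sent to 0.
\<close>

lemma Hoelder_with_majorants:
  fixes g h :: "real \<Rightarrow> real"
  assumes pq: "1 < p" "1 < q" "1 / p + 1 / q = 1"
    and prod: "((\<lambda>y. g y * h y) has_integral I) S"
    and G: "(G has_integral J) S" "\<And>y. y \<in> S \<Longrightarrow> \<bar>g y\<bar> powr p \<le> G y"
    and H: "(H has_integral K) S" "\<And>y. y \<in> S \<Longrightarrow> \<bar>h y\<bar> powr q \<le> H y"
  shows "\<bar>I\<bar> \<le> J powr (1 / p) * K powr (1 / q)"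
proof -
  have "0 \<le> G y" "0 \<le> H y" if "y \<in> S" for y
    using G(2)[OF that] H(2)[OF that] powr_ge_zero order_trans by blast+
  then have nonneg: "0 \<le> J" "0 \<le> K"
    using G(1) H(1) by (auto intro: has_integral_nonneg)
  have enlarged: "\<bar>I\<bar> \<le> (J + \<epsilon>) powr (1 / p) * (K + \<epsilon>) powr (1 / q)" if "0 < \<epsilon>" for \<epsilon>
  proof -
    define A B where "A = (J + \<epsilon>) powr (1 / p)" and "B = (K + \<epsilon>) powr (1 / q)"
    define M where "M y = A * B * (G y / (J + \<epsilon>) / p + H y / (K + \<epsilon>) / q)" for y
    have pos: "0 < A" "0 < B" "0 < J + \<epsilon>" "0 < K + \<epsilon>"
      using nonneg that by (auto simp: A_def B_def)
    have A_powr: "A powr p = J + \<epsilon>" and B_powr: "B powr q = K + \<epsilon>"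
      using pos pq by (auto simp: A_def B_def powr_powr)
    have M_bound: "\<bar>g y * h y\<bar> \<le> M y" if y: "y \<in> S" for y
    proof -
      have "(\<bar>g y\<bar> / A) * (\<bar>h y\<bar> / B) \<le> (\<bar>g y\<bar> / A) powr p / p + (\<bar>h y\<bar> / B) powr q / q"
        using pq pos by (intro Youngs_inequality) auto
      also have "\<dots> = \<bar>g y\<bar> powr p / (J + \<epsilon>) / p + \<bar>h y\<bar> powr q / (K + \<epsilon>) / q"
        using pos by (simp add: powr_divide A_powr B_powr)
      also have "\<dots> \<le> G y / (J + \<epsilon>) / p + H y / (K + \<epsilon>) / q"
        using pos pq G(2)[OF y] H(2)[OF y] by (intro add_mono divide_right_mono) auto
      finally have "A * B * ((\<bar>g y\<bar> / A) * (\<bar>h y\<bar> / B)) \<le> M y"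
        unfolding M_def using pos by (intro mult_left_mono) auto
      moreover have "A * B * ((\<bar>g y\<bar> / A) * (\<bar>h y\<bar> / B)) = \<bar>g y * h y\<bar>"
        using pos by (simp add: abs_mult)
      ultimately show ?thesis by simp
    qed
    let ?m = "A * B * (J / (J + \<epsilon>) / p + K / (K + \<epsilon>) / q)"
    have M_integral: "(M has_integral ?m) S"
      unfolding M_def by (intro has_integral_mult_right has_integral_add has_integral_divide G H)
    have "I \<le> ?m"
      using M_bound by (intro has_integral_le[OF prod M_integral]) (auto simp: abs_le_iff)
    moreover have "- I \<le> ?m"
      using M_bound by (intro has_integral_le[OF has_integral_neg[OF prod] M_integral])
        (auto simp: abs_le_iff)
    moreover have "?m \<le> A * B * (1 / p + 1 / q)"
      using pos pq that by (intro mult_left_mono add_mono divide_right_mono) auto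
    ultimately show ?thesis
      using pq by (simp add: A_def B_def abs_le_iff)
  qed
  have "((\<lambda>\<epsilon>. (J + \<epsilon>) powr (1 / p) * (K + \<epsilon>) powr (1 / q)) \<longlongrightarrow>
      (J + 0) powr (1 / p) * (K + 0) powr (1 / q)) (at_right 0)"
    using pq nonneg
    by (intro tendsto_intros)
      (auto intro!: eventually_mono[OF eventually_at_right_less[of 0]] disjI2)
  moreover have "eventually (\<lambda>\<epsilon>. \<bar>I\<bar> \<le> (J + \<epsilon>) powr (1 / p) * (K + \<epsilon>) powr (1 / q)) (at_right 0)"
    using enlarged eventually_at_right_less[of "0::real"] by (auto elim: eventually_mono)
  ultimately show ?thesis
    using tendsto_lowerbound[of _ _ "at_right (0::real)" "\<bar>I\<bar>"] by simp
qed

text \<open>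
  Both increasing and decreasing affine functions are covered, so that \<open>\<theta>\<close> and \<open>1 - \<theta>\<close> are handled
  alike. An endpoint value may be 0, and the power rule for differentiation is not available there; but the
  affine function is positive in the interior of the interval, and the antiderivative is continuous up
  to the endpoints.
\<close>

lemma has_integral_affine_powr:
  fixes a b c d r :: real
  assumes "a < b" and cd: "0 \<le> c" "0 \<le> d" "c \<noteq> d" and r: "0 < r"
  shows "((\<lambda>y. (c + (y - a) / (b - a) * (d - c)) powr r) has_integral
      (b - a) * ((d powr (r + 1) - c powr (r + 1)) / ((r + 1) * (d - c)))) {a..b}"
proof -
  define l where "l y = c + (y - a) / (b - a) * (d - c)" for y
  define F where "F y = (b - a) / ((r + 1) * (d - c)) * l y powr (r + 1)" for y
  have l_alt: "l y = (y - a) / (b - a) * d + (b - y) / (b - a) * c" for y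
  proof -
    have "(b - y) / (b - a) = 1 - (y - a) / (b - a)"
      using \<open>a < b\<close> by (simp add: diff_divide_eq_iff)
    then show ?thesis
      unfolding l_def by (simp only: left_diff_distrib right_diff_distrib)
  qed
  have l_nonneg: "0 \<le> l y" if "y \<in> {a..b}" for y
    unfolding l_alt using that assms by (auto intro!: add_nonneg_nonneg mult_nonneg_nonneg)
  have l_pos: "0 < l y" if "y \<in> {a<..<b}" for y
  proof -
    have "l y \<noteq> 0"
      unfolding l_alt using that cd by (subst add_nonneg_eq_0_iff) auto
    then show ?thesis
      using l_nonneg[of y] that by (auto simp: less_le)
  qed
  have "((\<lambda>y. l y powr r) has_integral F b - F a) {a..b}"
  proof (rule fundamental_theorem_of_calculus_interior)
    have "continuous_on {a..b} l"
      unfolding l_def using \<open>a < b\<close> by (intro continuous_intros) auto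
    then show "continuous_on {a..b} F"
      unfolding F_def using l_nonneg r
      by (intro continuous_on_mult continuous_on_const continuous_on_powr') auto
    show "(F has_vector_derivative l y powr r) (at y)" if y: "y \<in> {a<..<b}" for y
    proof -
      have "(l has_real_derivative (d - c) / (b - a)) (at y)"
        unfolding l_def using \<open>a < b\<close> by (auto intro!: derivative_eq_intros)
      from DERIV_fun_powr[OF this l_pos[OF y], of "r + 1"]
      have "((\<lambda>y. l y powr (r + 1)) has_real_derivative
          (r + 1) * l y powr r * ((d - c) / (b - a))) (at y)"
        by simp
      from DERIV_cmult[OF this, of "(b - a) / ((r + 1) * (d - c))"]
      have "(F has_real_derivative (b - a) / ((r + 1) * (d - c)) *
          ((r + 1) * l y powr r * ((d - c) / (b - a)))) (at y)"
        by (simp add: F_def[abs_def])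
      moreover have "(b - a) / ((r + 1) * (d - c)) *
          ((r + 1) * l y powr r * ((d - c) / (b - a))) = l y powr r"
        using assms by simp
      ultimately show ?thesis
        by (simp add: has_real_derivative_iff_has_vector_derivative)
    qed
  qed (use \<open>a < b\<close> in simp)
  moreover have "l a = c" "l b = d"
    using \<open>a < b\<close> by (auto simp: l_def)
  then have "F b - F a = (b - a) * ((d powr (r + 1) - c powr (r + 1)) / ((r + 1) * (d - c)))"
    by (simp only: F_def flip: right_diff_distrib) simp
  ultimately show ?thesis
    by (simp add: l_def)
qed

text \<open>
  The estimate for a single subinterval, already multiplied by its length, so that it also holds for
  the degenerate interval that occurs when \<open>x\<close> is an endpoint. The numbers \<open>u\<close> and \<open>v\<close> are the
  values of the weight at \<open>a\<close> and \<open>b\<close>: the same weight profile is stretched over each subinterval, which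
  is why the same mean \<open>L\<^sub>p(u, v)\<close> comes out both times.
\<close>

lemma weighted_integral_deriv_bound:
  fixes f f' :: "real \<Rightarrow> real" and a b u v p q s :: real
  assumes "a \<le> b"
    and deriv: "\<And>y. y \<in> {a..b} \<Longrightarrow> (f has_real_derivative f' y) (at y)"
    and uv: "0 < u" "u < v"
    and pq: "1 < p" "1 < q" "1 / p + 1 / q = 1" and s: "0 < s"
    and conv: "s_convex_on s {a..b} (\<lambda>y. \<bar>f' y\<bar> powr q)"
  shows "\<bar>(b - a) * (v * f b - u * f a) - (v - u) * integral {a..b} f\<bar>
    \<le> (b - a)\<^sup>2 * gen_log_mean p u v * ((\<bar>f' a\<bar> powr q + \<bar>f' b\<bar> powr q) / (s + 1)) powr (1 / q)"
proof (cases "a = b")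
  case False
  with \<open>a \<le> b\<close> have ab: "a < b" by simp
  define W where "W y = u + (y - a) / (b - a) * (v - u)" for y
  define Fa Fb where "Fa = \<bar>f' a\<bar> powr q" and "Fb = \<bar>f' b\<bar> powr q"
  define H where "H y = (0 + (y - a) / (b - a) * (1 - 0)) powr s * Fb
      + (1 + (y - a) / (b - a) * (0 - 1)) powr s * Fa" for y
  define N where "N = (v powr (p + 1) - u powr (p + 1)) / ((p + 1) * (v - u))"
  let ?I = "v * f b - u * f a - (v - u) / (b - a) * integral {a..b} f"

  have prod: "((\<lambda>y. W y * f' y) has_integral ?I) {a..b}"
  proof -
    have "((\<lambda>y. (v - u) / (b - a) * f y + W y * f' y) has_integral W b * f b - W a * f a) {a..b}"
    proof (rule fundamental_theorem_of_calculus)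
      fix y assume y: "y \<in> {a..b}"
      have "((\<lambda>y. W y * f y) has_real_derivative (v - u) / (b - a) * f y + W y * f' y) (at y)"
        unfolding W_def using ab by (auto intro!: derivative_eq_intros deriv[OF y])
      then show "((\<lambda>y. W y * f y) has_vector_derivative (v - u) / (b - a) * f y + W y * f' y)
          (at y within {a..b})"
        by (simp add: has_real_derivative_iff_has_vector_derivative has_vector_derivative_at_within)
    qed (use ab in simp)
    moreover have "f integrable_on {a..b}"
      using DERIV_isCont[OF deriv]
      by (intro integrable_continuous_real continuous_at_imp_continuous_on) auto
    then have "((\<lambda>y. (v - u) / (b - a) * f y) has_integral
        (v - u) / (b - a) * integral {a..b} f) {a..b}"
      by (intro has_integral_mult_right integrable_integral)
    ultimately have "((\<lambda>y. (v - u) / (b - a) * f y + W y * f' y - (v - u) / (b - a) * f y)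
        has_integral W b * f b - W a * f a - (v - u) / (b - a) * integral {a..b} f) {a..b}"
      by (rule has_integral_diff)
    moreover have "W a = u" "W b = v"
      using ab by (auto simp: W_def)
    ultimately show ?thesis by simp
  qed

  have W_int: "((\<lambda>y. W y powr p) has_integral (b - a) * N) {a..b}"
    unfolding W_def N_def using ab uv pq by (intro has_integral_affine_powr) auto
  have W_pos: "0 < W y" if "y \<in> {a..b}" for y
    unfolding W_def using that uv ab by (intro add_pos_nonneg mult_nonneg_nonneg) auto

  have H_int: "(H has_integral (b - a) * ((Fa + Fb) / (s + 1))) {a..b}"
  proof -
    have "(H has_integral
        (b - a) * ((1 powr (s + 1) - 0 powr (s + 1)) / ((s + 1) * (1 - 0))) * Fb +
        (b - a) * ((0 powr (s + 1) - 1 powr (s + 1)) / ((s + 1) * (0 - 1))) * Fa) {a..b}"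
      unfolding H_def using ab s
      by (intro has_integral_add has_integral_mult_left has_integral_affine_powr) auto
    moreover have "(b - a) * ((1 powr (s + 1) - 0 powr (s + 1)) / ((s + 1) * (1 - 0))) * Fb +
        (b - a) * ((0 powr (s + 1) - 1 powr (s + 1)) / ((s + 1) * (0 - 1))) * Fa
        = (b - a) * ((Fa + Fb) / (s + 1))"
      using s by (simp add: divide_simps) (simp add: algebra_simps)
    ultimately show ?thesis by simp
  qed
  have H_bound: "\<bar>f' y\<bar> powr q \<le> H y" if y: "y \<in> {a..b}" for y
  proof -
    define t where "t = (y - a) / (b - a)"
    have "t \<in> {0..1}"
      using y ab by (auto simp: t_def divide_simps)
    moreover have "t * (b - a) = y - a"
      using ab by (simp add: t_def)
    then have "y = t * b + (1 - t) * a"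
      by (simp add: algebra_simps)
    ultimately have "\<bar>f' y\<bar> powr q \<le> t powr s * Fb + (1 - t) powr s * Fa"
      using conv ab unfolding s_convex_on_def Fa_def Fb_def by simp
    then show ?thesis
      by (simp add: H_def t_def)
  qed

  have "\<bar>?I\<bar> \<le> ((b - a) * N) powr (1 / p) * ((b - a) * ((Fa + Fb) / (s + 1))) powr (1 / q)"
    using W_pos by (intro Hoelder_with_majorants[OF pq prod W_int _ H_int H_bound]) fastforce+
  also have "\<dots> = (b - a) powr (1 / p + 1 / q) * (N powr (1 / p) * ((Fa + Fb) / (s + 1)) powr (1 / q))"
  proof -
    have "u powr (p + 1) \<le> v powr (p + 1)"
      using uv pq by (intro powr_mono2) auto
    then have "0 \<le> N"
      unfolding N_def using uv pq by (intro divide_nonneg_nonneg) auto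
    moreover have "0 \<le> (Fa + Fb) / (s + 1)"
      using s by (simp add: Fa_def Fb_def)
    ultimately show ?thesis
      using ab by (simp add: powr_mult powr_add mult_ac del: times_divide_eq_right)
  qed
  also have "\<dots> = (b - a) * (gen_log_mean p u v * ((Fa + Fb) / (s + 1)) powr (1 / q))"
    using ab pq by (simp add: gen_log_mean_def N_def)
  finally have "(b - a) * \<bar>?I\<bar>
      \<le> (b - a) * ((b - a) * (gen_log_mean p u v * ((Fa + Fb) / (s + 1)) powr (1 / q)))"
    using ab by (intro mult_left_mono) auto
  moreover have "(b - a) * \<bar>?I\<bar> = \<bar>(b - a) * ?I\<bar>"
    using ab by (simp add: abs_mult)
  moreover have "(b - a) * ?I = (b - a) * (v * f b - u * f a) - (v - u) * integral {a..b} f"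
    using ab by (simp add: right_diff_distrib)
  ultimately show ?thesis
    by (simp add: Fa_def Fb_def power2_eq_square mult_ac)
qed simp

theorem theorem6:
  fixes f :: "real \<Rightarrow> real" and u v p q s x :: real
  assumes "\<And>y. 0 < y \<Longrightarrow> f differentiable (at y)"
    and "0 < u" and "u < v"
    and "deriv f absolutely_integrable_on {u..v}"
    and "1 < q" and "1 / p + 1 / q = 1"
    and "0 < s" and "s \<le> 1"
    and "s_convex_on s {u..v} (\<lambda>y. \<bar>deriv f y\<bar> powr q)"
    and "x \<in> {u..v}"
  shows "\<bar>((v - x) * (v * f v - u * f x) + (x - u) * (v * f x - u * f u)) / (v - u)\<^sup>2
            - 1 / (v - u) * (LINT \<mu>:{u..v}|lebesgue. f \<mu>)\<bar>
         \<le> (v - x)\<^sup>2 / (v - u)\<^sup>2 * gen_log_mean p u v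
              * ((\<bar>deriv f x\<bar> powr q + \<bar>deriv f v\<bar> powr q) / (s + 1)) powr (1 / q)
           + (x - u)\<^sup>2 / (v - u)\<^sup>2 * gen_log_mean p u v
              * ((\<bar>deriv f x\<bar> powr q + \<bar>deriv f u\<bar> powr q) / (s + 1)) powr (1 / q)"
proof -
  note uv = \<open>0 < u\<close> \<open>u < v\<close>
  have "1 / p = 1 - 1 / q"
    using assms(6) by simp
  then have "0 < 1 / p" "1 / p < 1"
    using \<open>1 < q\<close> by auto
  then have "1 < p"
    by (simp add: divide_simps split: if_splits)
  have deriv: "(f has_real_derivative deriv f y) (at y)" if "0 < y" for y
    using assms(1)[OF that] by (simp add: DERIV_deriv_iff_real_differentiable)
  have cont: "continuous_on {u..v} f"
    using DERIV_isCont[OF deriv] uv by (intro continuous_at_imp_continuous_on) auto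

  have piece: "\<bar>(b - a) * (v * f b - u * f a) - (v - u) * integral {a..b} f\<bar>
      \<le> (b - a)\<^sup>2 * gen_log_mean p u v *
        ((\<bar>deriv f a\<bar> powr q + \<bar>deriv f b\<bar> powr q) / (s + 1)) powr (1 / q)"
    if "u \<le> a" "a \<le> b" "b \<le> v" for a b
  proof (rule weighted_integral_deriv_bound)
    show "s_convex_on s {a..b} (\<lambda>y. \<bar>deriv f y\<bar> powr q)"
      using \<open>s_convex_on s {u..v} _\<close> that unfolding s_convex_on_def by auto
  qed (use that assms \<open>1 < p\<close> in \<open>auto intro!: deriv\<close>)

  let ?R1 = "(v - x) * (v * f v - u * f x) - (v - u) * integral {x..v} f"
  let ?R2 = "(x - u) * (v * f x - u * f u) - (v - u) * integral {u..x} f"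
  have "(LINT \<mu>:{u..v}|lebesgue. f \<mu>) = integral {u..v} f"
    using cont by (intro set_lebesgue_integral_eq_integral(2) absolutely_integrable_continuous_real)
  also have "\<dots> = integral {u..x} f + integral {x..v} f"
    using \<open>x \<in> {u..v}\<close> cont by (intro Henstock_Kurzweil_Integration.integral_combine[symmetric])
      (auto intro: integrable_continuous_real)
  finally have split: "((v - x) * (v * f v - u * f x) + (x - u) * (v * f x - u * f u)) / (v - u)\<^sup>2
      - 1 / (v - u) * (LINT \<mu>:{u..v}|lebesgue. f \<mu>) = (?R1 + ?R2) / (v - u)\<^sup>2"
    using uv by (simp add: divide_simps power2_eq_square) (simp add: algebra_simps)

  have "\<bar>?R1 + ?R2\<bar> \<le>
      (v - x)\<^sup>2 * gen_log_mean p u v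
        * ((\<bar>deriv f x\<bar> powr q + \<bar>deriv f v\<bar> powr q) / (s + 1)) powr (1 / q)
    + (x - u)\<^sup>2 * gen_log_mean p u v
        * ((\<bar>deriv f u\<bar> powr q + \<bar>deriv f x\<bar> powr q) / (s + 1)) powr (1 / q)"
    using piece[of x v] piece[of u x] \<open>x \<in> {u..v}\<close>
    by (intro order_trans[OF abs_triangle_ineq] add_mono) auto
  from divide_right_mono[OF this zero_le_power2[of "v - u"]] show ?thesis
    unfolding split abs_divide
    by (simp only: abs_power2 add_divide_distrib[of _ _ "(v - u)\<^sup>2"] times_divide_eq_left
        add.commute[of "\<bar>deriv f u\<bar> powr q"])
qed

end
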